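(* Let $k\ge2$, let $H_1,\dots,H_r$ be $k$-rainbow common graphs, let $\beta_1,\dots,\beta_r\ge0$, and for $\mathbf W\in\mathcal W_k$ set $T(\mathbf W)=\sum_{s=1}^r\beta_sR_{H_s,k}(\mathbf W)$. Let $\psi_n=\frac1{n^2}\log\sum_{\mathscr X\in\mathcal C_n^k}\exp\{n^2T(\mathbf W^{\mathscr X})\}$. Then $$\lim_{n\to\infty}\psi_n=\sum_{s=1}^r\beta_s\frac{k!}{(k-|E(H_s)|)!\,k^{|E(H_s)|}}+\tfrac12\log k.$$ Moreover, the constant graphon $\mathbf U^{(k)}\equiv(\frac1k,\dots,\frac1k)$ is the unique maximizer of $\mathbf W\mapsto T(\mathbf W)-\frac12\mathcal I(\mathbf W)$ over $k$-colored probability graphons.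
   Context: Let $[k]=\{1,\dots,k\}$ and $\Delta_k=\{\mu\in[0,1]^k:\sum_a\mu_a=1\}$. A $k$-colored probability graphon is a measurable symmetric map $\mathbf W=(W_1,\dots,W_k):[0,1]^2\to\Delta_k$ (identified when equal almost everywhere); $\mathcal W_k$ is the set of these. For a finite simple graph $H$ and $\sigma:E(H)\to[k]$, $$t((H,\sigma),\mathbf W)=\int_{[0,1]^{V(H)}}\prod_{(u,v)\in E(H)}W_{\sigma((u,v))}(x_u,x_v)\prod_{v\in V(H)}dx_v .$$ For a finite simple graph $H$ with $1\le|E(H)|\le k$ set $R_{H,k}(\mathbf W)=\sum_{\sigma}t((H,\sigma),\mathbf W)$, the sum over all injective maps $\sigma:E(H)\to[k]$. $H$ is $k$-rainbow common if $R_{H,k}$ is maximized over $\mathcal W_k$ at the constant graphon $(\frac1k,\dots,\frac1k)$, i.e. $\sup_{\mathbf W\in\mathcal W_k}R_{H,k}(\mathbf W)=\frac{k!}{(k-|E(H)|)!\,k^{|E(H)|}}$. $\mathcal C_n^k$ is the set of all maps $\mathscr X$ from the edge set of the complete graph $K_n$ on $\{1,\dots,n\}$ to $[k]$. The empirical graphon $\mathbf W^{\mathscr X}\in\mathcal W_k$ has $W^{\mathscr X}_a(x,y)=\mathbf 1\{\mathscr X(\{u,v\})=a\}$ for $(x,y)\in(\frac{u-1}n,\frac un]\times(\frac{v-1}n,\frac vn]$, $u\ne v$, and $\mathbf W^{\mathscr X}=(\frac1k,\dots,\frac1k)$ on the diagonal blocks $u=v$. $\mathcal I(\mathbf W)=\sum_{a=1}^k\int_{[0,1]^2}W_a\log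 W_a\,dx\,dy$, with $0\log 0=0$. *)

theory Defs
  imports "HOL-Analysis.Analysis"
begin

section \<open>Finite simple graphs\<close>

record 'v graph =
  verts :: "'v set"
  edges :: "'v set set"

definition finite_simple_graph :: "'v graph \<Rightarrow> bool" where
  "finite_simple_graph H \<longleftrightarrow>
     finite (verts H) \<and> (\<forall>e\<in>edges H. e \<subseteq> verts H \<and> card e = 2)"

definition complete_edges :: "nat \<Rightarrow> nat set set" where
  "complete_edges n = {e. e \<subseteq> {1..n} \<and> card e = 2}"

definition colorings :: "nat \<Rightarrow> nat \<Rightarrow> (nat set \<Rightarrow> nat) set" where
  "colorings n k = complete_edges n \<rightarrow>\<^sub>E {1..k}"

section \<open>Colored probability graphons\<close>

definition unit_measure :: "real measure" where
  "unit_measure = restrict_space lborel {0..1}"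

definition prob_simplex :: "nat \<Rightarrow> (nat \<Rightarrow> real) set" where
  "prob_simplex k = {\<mu>. (\<forall>a\<in>{1..k}. \<mu> a \<in> {0..1}) \<and> (\<Sum>a\<in>{1..k}. \<mu> a) = 1}"

text \<open>A graphon is written \<open>W a x y\<close> with the color \<open>a\<close> first. Only the values for
  colors in \<open>{1..k}\<close> and points of the unit square matter. Elements of \<open>graphons k\<close> are
  representatives (Borel measurable and symmetric everywhere on the square); the identification of
  graphons that agree almost everywhere is the relation \<open>graphon_eq k\<close>.\<close>

type_synonym graphon = "nat \<Rightarrow> real \<Rightarrow> real \<Rightarrow> real"

definition graphons :: "nat \<Rightarrow> graphon set" where
  "graphons k = {W.
     (\<forall>a\<in>{1..k}. (\<lambda>(x, y). W a x y) \<in> borel_measurable (unit_measure \<Otimes>\<^sub>M unit_measure)) \<and>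
     (\<forall>a\<in>{1..k}. \<forall>x\<in>{0..1}. \<forall>y\<in>{0..1}. W a x y = W a y x) \<and>
     (\<forall>x\<in>{0..1}. \<forall>y\<in>{0..1}. (\<lambda>a. W a x y) \<in> prob_simplex k)}"

definition graphon_eq :: "nat \<Rightarrow> graphon \<Rightarrow> graphon \<Rightarrow> bool" where
  "graphon_eq k W W' \<longleftrightarrow>
     (AE (x, y) in unit_measure \<Otimes>\<^sub>M unit_measure. \<forall>a\<in>{1..k}. W a x y = W' a x y)"

definition uniform_graphon :: "nat \<Rightarrow> graphon" where
  "uniform_graphon k = (\<lambda>a x y. 1 / real k)"

section \<open>Colored densities and rainbow densities\<close>

text \<open>The edge \<open>e = {u, v}\<close> contributes the factor \<open>W (\<sigma> e) (x u) (x v)\<close>. The vertex order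
  serves only to name the two endpoints of \<open>e\<close>; by symmetry of \<open>W\<close> their order is irrelevant.\<close>

definition hom_density :: "'v::linorder graph \<Rightarrow> ('v set \<Rightarrow> nat) \<Rightarrow> graphon \<Rightarrow> real" where
  "hom_density H \<sigma> W =
     (LINT x | (\<Pi>\<^sub>M v\<in>verts H. unit_measure).
        (\<Prod>e\<in>edges H. W (\<sigma> e) (x (Min e)) (x (Max e))))"

definition rainbow_density :: "'v::linorder graph \<Rightarrow> nat \<Rightarrow> graphon \<Rightarrow> real" where
  "rainbow_density H k W =
     (\<Sum>\<sigma> | \<sigma> \<in> edges H \<rightarrow>\<^sub>E {1..k} \<and> inj_on \<sigma> (edges H). hom_density H \<sigma> W)"

definition uniform_rainbow_value :: "'v graph \<Rightarrow> nat \<Rightarrow> real" where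
  "uniform_rainbow_value H k =
     fact k / (fact (k - card (edges H)) * real k ^ card (edges H))"

text \<open>The supremum is a genuine one: each \<open>hom_density H \<sigma> W\<close> with \<open>W \<in> graphons k\<close> lies in
  \<open>{0..1}\<close>, so the values of \<open>rainbow_density H k\<close> are bounded.\<close>

definition rainbow_common :: "nat \<Rightarrow> 'v::linorder graph \<Rightarrow> bool" where
  "rainbow_common k H \<longleftrightarrow>
     finite_simple_graph H \<and> 1 \<le> card (edges H) \<and> card (edges H) \<le> k \<and>
     (SUP W\<in>graphons k. rainbow_density H k W) = uniform_rainbow_value H k"

section \<open>Empirical graphon, entropy and free energy\<close>

text \<open>\<open>block n x\<close> is the \<open>u\<close> with \<open>(u - 1) / n < x \<le> u / n\<close>. The half-open blocks
  miss the null set where a coordinate is \<open>0\<close> (block index \<open>0\<close>); there the empirical graphon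
  is given the uniform value, as on the diagonal blocks.\<close>

definition block :: "nat \<Rightarrow> real \<Rightarrow> nat" where
  "block n x = nat \<lceil>real n * x\<rceil>"

definition empirical_graphon :: "nat \<Rightarrow> nat \<Rightarrow> (nat set \<Rightarrow> nat) \<Rightarrow> graphon" where
  "empirical_graphon n k X a x y =
     (let u = block n x; v = block n y in
      if u = v \<or> u = 0 \<or> v = 0 then 1 / real k
      else if X {u, v} = a then 1 else 0)"

text \<open>The convention \<open>0 log 0 = 0\<close> holds since \<open>0 * ln 0 = 0\<close>.\<close>

definition graphon_entropy :: "nat \<Rightarrow> graphon \<Rightarrow> real" where
  "graphon_entropy k W =
     (\<Sum>a\<in>{1..k}. LINT (x, y) | (unit_measure \<Otimes>\<^sub>M unit_measure). W a x y * ln (W a x y))"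

definition rainbow_hamiltonian ::
  "nat \<Rightarrow> nat \<Rightarrow> (nat \<Rightarrow> real) \<Rightarrow> (nat \<Rightarrow> 'v::linorder graph) \<Rightarrow> graphon \<Rightarrow> real" where
  "rainbow_hamiltonian k r \<beta> H W = (\<Sum>s\<in>{1..r}. \<beta> s * rainbow_density (H s) k W)"

definition free_energy ::
  "nat \<Rightarrow> nat \<Rightarrow> (nat \<Rightarrow> real) \<Rightarrow> (nat \<Rightarrow> 'v::linorder graph) \<Rightarrow> nat \<Rightarrow> real" where
  "free_energy k r \<beta> H n =
     1 / real n ^ 2 *
     ln (\<Sum>X\<in>colorings n k.
           exp (real n ^ 2 * rainbow_hamiltonian k r \<beta> H (empirical_graphon n k X)))"

end

theory Submission
  imports Defs "HOL-Probability.Infinite_Product_Measure"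
begin

text \<open>Write \<open>C\<close> for the value of the Hamiltonian at the uniform graphon; since all graphs
  are rainbow common, \<open>C\<close> is its maximum. Bounding every summand of the partition function by
  \<open>exp (n\<^sup>2 C)\<close> and counting the colorings gives the upper bound for the free energy. For the lower
  bound, Jensen's inequality replaces the Hamiltonian by its average over uniformly random
  colorings. Almost every tuple of points of the unit interval has distinct coordinates, so its
  points eventually lie in distinct blocks and the colors seen by the edges are independent and
  uniform; by dominated convergence the averaged densities tend to those of the uniform graphon.
  Finally, the uniform graphon maximizes the Hamiltonian and, as the only one almost everywhere,
  minimizes the entropy, by Gibbs' inequality applied pointwise.\<close>

section \<open>The unit interval and its powers\<close>

lemma prob_space_unit_measure: "prob_space unit_measure"
  unfolding unit_measure_def by (rule prob_spaceI) (simp add: emeasure_restrict_space space_restrict_space)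

lemma space_unit_measure [simp]: "space unit_measure = {0..1}"
  by (simp add: unit_measure_def space_restrict_space)

lemma prob_space_unit_square: "prob_space (unit_measure \<Otimes>\<^sub>M unit_measure)"
  by (intro prob_space_pair prob_space_unit_measure)

lemma prob_space_unit_cube: "prob_space (\<Pi>\<^sub>M v\<in>V. unit_measure)"
  by (intro prob_space_PiM prob_space_unit_measure)

text \<open>Measurability depends only on the sigma-algebra, so Borel functions on the real line can
  be restricted to the unit interval without reference to \<open>lborel\<close>.\<close>

lemma measurable_unit_measure_eq:
  "measurable unit_measure M = measurable (restrict_space borel {0..1}) M"
  unfolding unit_measure_def by (rule measurable_cong_sets) (auto simp: sets_restrict_space)

lemma measurable_id_unit_measure: "(\<lambda>x. x) \<in> unit_measure \<rightarrow>\<^sub>M borel"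
  unfolding measurable_unit_measure_eq by (rule measurable_restrict_space1) simp

lemma AE_unit_measure_notin_finite:
  assumes "finite A"
  shows "AE x in unit_measure. x \<notin> A"
proof -
  have "AE x in lborel. x \<notin> A"
    using assms by (intro AE_not_in) (simp add: finite_imp_null_set_lborel)
  then show ?thesis
    unfolding unit_measure_def by (subst AE_restrict_space_iff) auto
qed

lemma component_measurable_unit_cube:
  "v \<in> V \<Longrightarrow> (\<lambda>x. x v) \<in> (\<Pi>\<^sub>M v\<in>V. unit_measure) \<rightarrow>\<^sub>M borel"
  using measurable_compose[OF measurable_component_singleton[of v V "\<lambda>_. unit_measure"] measurable_id_unit_measure]
  by simp

text \<open>By Tonelli, integrate over the coordinate \<open>u\<close> first: with the others fixed,
  the forbidden values of \<open>x u\<close> are \<open>0\<close> and the finitely many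
  \<open>x v\<close>, a null set.\<close>

lemma AE_unit_cube_coordinate_distinct:
  assumes "finite V" "u \<in> V"
  shows "AE x in (\<Pi>\<^sub>M v\<in>V. unit_measure). x u \<noteq> 0 \<and> (\<forall>v\<in>V - {u}. x u \<noteq> x v)"
proof -
  define V' where "V' = V - {u}"
  have V: "V = insert u V'" "finite V'" "u \<notin> V'" using assms by (auto simp: V'_def)
  interpret P: product_sigma_finite "\<lambda>_. unit_measure"
    by (simp add: product_sigma_finite_def prob_space_unit_measure prob_space_imp_sigma_finite)
  define M where "M = (\<Pi>\<^sub>M v\<in>insert u V'. unit_measure)"
  define N where "N = {x\<in>space M. \<not> (x u \<noteq> 0 \<and> (\<forall>v\<in>V'. x u \<noteq> x v))}"
  have u: "(\<lambda>x. x u) \<in> M \<rightarrow>\<^sub>M borel"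
    unfolding M_def by (rule component_measurable_unit_cube) simp
  have v: "v \<in> V' \<Longrightarrow> (\<lambda>x. x v) \<in> M \<rightarrow>\<^sub>M borel" for v
    unfolding M_def by (rule component_measurable_unit_cube) simp
  have "N = {x\<in>space M. x u = 0} \<union> (\<Union>v\<in>V'. {x\<in>space M. x u = x v})" by (auto simp: N_def)
  also have "\<dots> \<in> sets M"
    using V(2) borel_measurable_eq[OF u borel_measurable_const] borel_measurable_eq[OF u v]
    by (intro sets.Un sets.finite_UN) auto
  finally have [measurable]: "N \<in> sets M" .
  have "emeasure M N = (\<integral>\<^sup>+ x. indicator N x \<partial>M)" by simp
  also have "\<dots> = (\<integral>\<^sup>+ x. (\<integral>\<^sup>+ y. indicator N (x(u := y)) \<partial>unit_measure) \<partial>(\<Pi>\<^sub>M v\<in>V'. unit_measure))"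
    unfolding M_def
    by (rule P.product_nn_integral_insert) (use V in \<open>auto simp flip: M_def\<close>)
  also have "\<dots> = (\<integral>\<^sup>+ x. 0 \<partial>(\<Pi>\<^sub>M v\<in>V'. unit_measure))"
  proof (rule nn_integral_cong)
    fix x
    have "AE y in unit_measure. y \<notin> insert 0 (x ` V')"
      using V by (intro AE_unit_measure_notin_finite) auto
    then have "AE y in unit_measure. indicator N (x(u := y)) = (0::ennreal)"
      by eventually_elim (use V in \<open>auto simp: N_def indicator_def\<close>)
    then have "(\<integral>\<^sup>+ y. indicator N (x(u := y)) \<partial>unit_measure) = (\<integral>\<^sup>+ y. 0 \<partial>unit_measure)"
      by (rule nn_integral_cong_AE)
    then show "(\<integral>\<^sup>+ y. indicator N (x(u := y)) \<partial>unit_measure) = 0" by simp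
  qed
  finally have "N \<in> null_sets M" by auto
  then have AE: "AE x in M. x u \<noteq> 0 \<and> (\<forall>v\<in>V'. x u \<noteq> x v)"
    by (rule AE_I') (auto simp: N_def)
  have M_eq: "M = (\<Pi>\<^sub>M v\<in>V. unit_measure)" by (simp add: M_def V(1))
  from AE show ?thesis unfolding M_eq V'_def .
qed

text \<open>The exceptional null sets, one per coordinate, are united. Positivity matters because
  the point \<open>0\<close> falls in block \<open>0\<close>, where the empirical graphon only has a
  default value.\<close>

lemma AE_unit_cube_distinct:
  assumes "finite V"
  shows "AE x in (\<Pi>\<^sub>M v\<in>V. unit_measure). inj_on x V \<and> (\<forall>v\<in>V. x v \<in> {0<..1})"
proof -
  have "AE x in (\<Pi>\<^sub>M v\<in>V. unit_measure). \<forall>u\<in>V. x u \<noteq> 0 \<and> (\<forall>v\<in>V - {u}. x u \<noteq> x v)"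
    using assms by (intro AE_finite_allI AE_unit_cube_coordinate_distinct)
  moreover have "AE x in (\<Pi>\<^sub>M v\<in>V. unit_measure). \<forall>v\<in>V. x v \<in> {0..1}"
    by (rule AE_I2) (auto simp: space_PiM PiE_iff)
  ultimately show ?thesis
    by eventually_elim (force simp: inj_on_def order_less_le)
qed

section \<open>Blocks and empirical graphons\<close>

lemma block_le: "x \<le> 1 \<Longrightarrow> block n x \<le> n"
proof -
  assume "x \<le> 1"
  then have "real n * x \<le> real n" by (simp add: mult_left_le)
  then show ?thesis unfolding block_def by linarith
qed

lemma block_pos: "0 < x \<Longrightarrow> 0 < n \<Longrightarrow> 0 < block n x"
  unfolding block_def by (simp add: less_ceiling_iff)

lemma block_distinct:
  assumes "0 \<le> x" "0 \<le> y" "1 < real n * \<bar>x - y\<bar>"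
  shows "block n x \<noteq> block n y"
proof
  assume eq: "block n x = block n y"
  have nonneg: "0 \<le> real n * x" "0 \<le> real n * y" using assms by auto
  \<comment> \<open>\<open>nat\<close> sends every negative integer to \<open>0\<close>;
    nonnegativity of the ceilings is what allows it to be cancelled.\<close>
  then have "0 \<le> \<lceil>real n * x\<rceil>" "0 \<le> \<lceil>real n * y\<rceil>" by linarith+
  with eq have "\<lceil>real n * x\<rceil> = \<lceil>real n * y\<rceil>" unfolding block_def by (simp add: nat_eq_iff)
  then have "\<bar>real n * x - real n * y\<bar> \<le> 1" by linarith
  with assms show False by (simp add: abs_mult flip: right_diff_distrib)
qed

lemma eventually_block_distinct:
  assumes "0 \<le> x" "0 \<le> y" "x \<noteq> y"
  shows "\<forall>\<^sub>F n in sequentially. block n x \<noteq> block n y"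
proof -
  obtain N :: nat where N: "1 < real N * \<bar>x - y\<bar>"
    using reals_Archimedean3[of "\<bar>x - y\<bar>"] assms by auto
  have "block n x \<noteq> block n y" if "n \<ge> N" for n
  proof (rule block_distinct[OF assms(1,2)])
    have "real N * \<bar>x - y\<bar> \<le> real n * \<bar>x - y\<bar>" using that by (intro mult_right_mono) auto
    with N show "1 < real n * \<bar>x - y\<bar>" by linarith
  qed
  then show ?thesis by (auto simp: eventually_sequentially)
qed

text \<open>Only finitely many pairs of vertices have to be separated, so their thresholds have a
  common bound. This bound depends on \<open>x\<close>, which is why the later convergence is
  pointwise.\<close>

lemma eventually_block_inj:
  assumes "finite V" "inj_on x V" "\<forall>v\<in>V. x v \<in> {0<..1}"
  shows "\<forall>\<^sub>F n in sequentially. inj_on (\<lambda>v. block n (x v)) V \<and> (\<forall>v\<in>V. block n (x v) \<in> {1..n})"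
proof -
  have "\<forall>\<^sub>F n in sequentially. \<forall>u\<in>V. \<forall>v\<in>V - {u}. block n (x u) \<noteq> block n (x v)"
    using assms
    by (intro eventually_ball_finite ballI eventually_block_distinct)
       (auto simp: inj_on_def less_imp_le)
  moreover have "\<forall>\<^sub>F n in sequentially. n > 0" by (rule eventually_gt_at_top)
  ultimately show ?thesis
  proof eventually_elim
    case (elim n)
    have "block n (x v) \<in> {1..n}" if "v \<in> V" for v
      using that assms(3) elim(2) block_pos[of "x v" n] block_le[of "x v" n] by force
    with elim(1) show ?case by (auto simp: inj_on_def)
  qed
qed

lemma measurable_block [measurable]: "block n \<in> borel \<rightarrow>\<^sub>M count_space UNIV"
  unfolding block_def by measurable

text \<open>The empirical graphon sees the two points only through their block indices, which take
  countably many values. General \<open>f\<close> and \<open>g\<close> cover both the unit square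
  and pairs of coordinates of a cube.\<close>

lemma empirical_graphon_measurable:
  assumes [measurable]: "f \<in> M \<rightarrow>\<^sub>M borel" "g \<in> M \<rightarrow>\<^sub>M borel"
  shows "(\<lambda>z. empirical_graphon n k X a (f z) (g z)) \<in> borel_measurable M"
proof -
  define F where "F = (\<lambda>u v. if u = v \<or> u = 0 \<or> v = 0 then 1 / real k
      else if X {u, v} = a then 1 else 0)"
  have [measurable]: "(\<lambda>z. block n (f z)) \<in> M \<rightarrow>\<^sub>M count_space UNIV"
    "(\<lambda>z. block n (g z)) \<in> M \<rightarrow>\<^sub>M count_space UNIV" by measurable
  have "(\<lambda>z. F u (block n (g z))) \<in> borel_measurable M" for u
    by (rule measurable_compose_countable[where f = "\<lambda>v z. F u v" and g = "\<lambda>z. block n (g z)"]) simp_all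
  then have "(\<lambda>z. F (block n (f z)) (block n (g z))) \<in> borel_measurable M"
    by (rule measurable_compose_countable[where f = "\<lambda>u z. F u (block n (g z))"]) simp
  then show ?thesis by (simp add: empirical_graphon_def F_def Let_def)
qed

lemma empirical_graphon_mem_graphons:
  assumes "k \<ge> 1" "X \<in> colorings n k"
  shows "empirical_graphon n k X \<in> graphons k"
proof -
  have meas: "(\<lambda>(x, y). empirical_graphon n k X a x y)
      \<in> borel_measurable (unit_measure \<Otimes>\<^sub>M unit_measure)" for a
    unfolding case_prod_beta
    by (intro empirical_graphon_measurable measurable_compose[OF measurable_fst measurable_id_unit_measure]
        measurable_compose[OF measurable_snd measurable_id_unit_measure])
  have simplex: "(\<lambda>a. empirical_graphon n k X a x y) \<in> prob_simplex k"
    if "x \<in> {0..1}" "y \<in> {0..1}" for x y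
  proof (cases "block n x = block n y \<or> block n x = 0 \<or> block n y = 0")
    case True
    then have "empirical_graphon n k X a x y = 1 / real k" for a
      unfolding empirical_graphon_def Let_def by simp
    with assms show ?thesis unfolding prob_simplex_def by simp
  next
    case False
    then have *: "empirical_graphon n k X a x y = (if X {block n x, block n y} = a then 1 else 0)" for a
      unfolding empirical_graphon_def Let_def by simp
    \<comment> \<open>The blocks are distinct and lie in \<open>{1..n}\<close>, so \<open>X\<close>
      gives this pair a color in \<open>{1..k}\<close>, and exactly one of the \<open>k\<close>
      weights is 1.\<close>
    have "{block n x, block n y} \<in> complete_edges n"
      unfolding complete_edges_def using False that block_le[of x n] block_le[of y n] by auto
    with assms have "X {block n x, block n y} \<in> {1..k}" by (auto simp: colorings_def PiE_iff)
    then show ?thesis unfolding prob_simplex_def * by simp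
  qed
  have "empirical_graphon n k X a x y = empirical_graphon n k X a y x" for a x y
    by (auto simp: empirical_graphon_def Let_def insert_commute)
  with meas simplex show ?thesis unfolding graphons_def by blast
qed

lemma uniform_graphon_mem_graphons: "k \<ge> 1 \<Longrightarrow> uniform_graphon k \<in> graphons k"
  by (auto simp: graphons_def uniform_graphon_def prob_simplex_def)

lemma graphons_bounds:
  assumes "W \<in> graphons k" "a \<in> {1..k}" "x \<in> {0..1}" "y \<in> {0..1}"
  shows "0 \<le> W a x y" "W a x y \<le> 1"
  using assms by (auto simp: graphons_def prob_simplex_def)

section \<open>Colored densities\<close>

lemma finite_simple_graph_finite_edges:
  "finite_simple_graph H \<Longrightarrow> finite (edges H)"
  unfolding finite_simple_graph_def by (rule finite_subset[of _ "Pow (verts H)"]) auto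

lemma finite_simple_graph_edgeE:
  assumes "finite_simple_graph H" "e \<in> edges H"
  shows "e = {Min e, Max e}" "Min e \<noteq> Max e" "Min e \<in> verts H" "Max e \<in> verts H"
proof -
  obtain u v where e: "e = {u, v}" "u \<noteq> v"
    using assms by (auto simp: finite_simple_graph_def card_2_iff)
  then have *: "Min e = min u v" "Max e = max u v" by auto
  show "e = {Min e, Max e}" unfolding * using e by (auto simp: min_def max_def)
  show "Min e \<noteq> Max e" unfolding * using e(2) by (auto simp: min_def max_def)
  show "Min e \<in> verts H" "Max e \<in> verts H"
    using e assms by (auto simp: finite_simple_graph_def min_def max_def)
qed

lemma edge_weight_product_bounds:
  fixes H :: "'v::linorder graph"
  assumes "finite_simple_graph H" "\<sigma> \<in> edges H \<rightarrow> {1..k}" "W \<in> graphons k"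
    "x \<in> space (\<Pi>\<^sub>M v\<in>verts H. unit_measure)"
  shows "0 \<le> (\<Prod>e\<in>edges H. W (\<sigma> e) (x (Min e)) (x (Max e)))"
    "(\<Prod>e\<in>edges H. W (\<sigma> e) (x (Min e)) (x (Max e))) \<le> 1"
proof -
  have "0 \<le> W (\<sigma> e) (x (Min e)) (x (Max e)) \<and> W (\<sigma> e) (x (Min e)) (x (Max e)) \<le> 1"
    if "e \<in> edges H" for e
    using assms that finite_simple_graph_edgeE[OF assms(1) that] graphons_bounds[OF assms(3)]
    by (auto simp: space_PiM PiE_iff Pi_iff)
  then show "0 \<le> (\<Prod>e\<in>edges H. W (\<sigma> e) (x (Min e)) (x (Max e)))"
    "(\<Prod>e\<in>edges H. W (\<sigma> e) (x (Min e)) (x (Max e))) \<le> 1"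
    by (auto intro!: prod_nonneg prod_le_1)
qed

text \<open>The bound passes through the nonnegative integral, so integrability of the product is
  not established first; a non-integrable function would have Bochner integral \<open>0\<close>,
  which obeys the bound as well.\<close>

lemma hom_density_le_1:
  fixes H :: "'v::linorder graph"
  assumes "finite_simple_graph H" "\<sigma> \<in> edges H \<rightarrow> {1..k}" "W \<in> graphons k"
  shows "hom_density H \<sigma> W \<le> 1"
  unfolding hom_density_def
proof (rule integral_real_bounded)
  interpret prob_space "\<Pi>\<^sub>M v\<in>verts H. unit_measure" by (rule prob_space_unit_cube)
  have "(\<integral>\<^sup>+ x. ennreal (\<Prod>e\<in>edges H. W (\<sigma> e) (x (Min e)) (x (Max e))) \<partial>(\<Pi>\<^sub>M v\<in>verts H. unit_measure))
      \<le> (\<integral>\<^sup>+ x. 1 \<partial>(\<Pi>\<^sub>M v\<in>verts H. unit_measure))"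
    using edge_weight_product_bounds[OF assms] by (intro nn_integral_mono) auto
  then show "(\<integral>\<^sup>+ x. ennreal (\<Prod>e\<in>edges H. W (\<sigma> e) (x (Min e)) (x (Max e))) \<partial>(\<Pi>\<^sub>M v\<in>verts H. unit_measure))
      \<le> ennreal 1" by (simp add: emeasure_space_1)
qed simp

text \<open>A real supremum bounds its set only if that set is bounded above. The number of
  injective colorings is such a bound, since each density is at most 1.\<close>

lemma rainbow_density_le:
  fixes H :: "'v::linorder graph"
  assumes "rainbow_common k H" "W \<in> graphons k"
  shows "rainbow_density H k W \<le> uniform_rainbow_value H k"
proof -
  have H: "finite_simple_graph H" using assms by (simp add: rainbow_common_def)
  have "bdd_above (rainbow_density H k ` graphons k)"
  proof (rule bdd_aboveI2)
    fix W assume "W \<in> graphons k"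
    with H show "rainbow_density H k W
        \<le> (\<Sum>\<sigma> | \<sigma> \<in> edges H \<rightarrow>\<^sub>E {1..k} \<and> inj_on \<sigma> (edges H). 1)"
      unfolding rainbow_density_def
      by (intro sum_mono hom_density_le_1) (auto simp: PiE_def)
  qed
  with assms show ?thesis
    unfolding rainbow_common_def by (metis cSUP_upper)
qed

lemma card_inj_colorings:
  assumes "finite E" "card E \<le> k"
  shows "real (card {\<sigma>. \<sigma> \<in> E \<rightarrow>\<^sub>E {1..k} \<and> inj_on \<sigma> E}) = fact k / fact (k - card E)"
proof -
  \<comment> \<open>The injections are counted by a falling factorial; the induction turns it into a
    quotient of factorials.\<close>
  have "(\<Prod>i\<in>{0..<m}. real (k - i)) = fact k / fact (k - m)" if "m \<le> k" for m
    using that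
  proof (induction m)
    case (Suc m)
    then have "fact (k - m) = real (k - m) * fact (k - Suc m)"
      by (metis Suc_diff_le diff_Suc_Suc fact_Suc)
    with Suc show ?case by (simp add: field_simps)
  qed simp
  with assms show ?thesis
    using card_inj_on_subset_funcset[of E "{1..k}" E] by (simp add: comp_def)
qed

lemma hom_density_uniform:
  "hom_density H \<sigma> (uniform_graphon k) = (1 / real k) ^ card (edges H)"
proof -
  interpret prob_space "\<Pi>\<^sub>M v\<in>verts H. unit_measure" by (rule prob_space_unit_cube)
  show ?thesis unfolding hom_density_def uniform_graphon_def by (simp add: prob_space)
qed

text \<open>This sum arises twice: as the rainbow density of the uniform graphon and as the limit of
  the averaged empirical densities.\<close>

lemma sum_inj_colorings_const:
  assumes "finite_simple_graph H" "card (edges H) \<le> k"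
  shows "(\<Sum>\<sigma> | \<sigma> \<in> edges H \<rightarrow>\<^sub>E {1..k} \<and> inj_on \<sigma> (edges H). (1 / real k) ^ card (edges H))
    = uniform_rainbow_value H k"
  using card_inj_colorings[OF finite_simple_graph_finite_edges[OF assms(1)] assms(2)]
  by (simp add: uniform_rainbow_value_def power_divide)

lemma rainbow_density_uniform:
  assumes "finite_simple_graph H" "card (edges H) \<le> k"
  shows "rainbow_density H k (uniform_graphon k) = uniform_rainbow_value H k"
  unfolding rainbow_density_def hom_density_uniform by (rule sum_inj_colorings_const[OF assms])

section \<open>Averages over all colorings\<close>

lemma finite_complete_edges: "finite (complete_edges n)"
  unfolding complete_edges_def by (rule finite_subset[of _ "Pow {1..n}"]) auto

lemma finite_colorings: "finite (colorings n k)"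
  unfolding colorings_def by (intro finite_PiE finite_complete_edges) auto

lemma card_colorings: "card (colorings n k) = k ^ (n choose 2)"
  using n_subsets[of "{1..n}" 2]
  by (simp add: colorings_def card_funcsetE finite_complete_edges) (simp add: complete_edges_def)

text \<open>Under a uniformly random coloring the edge colors are independent and uniform, so each
  edge of \<open>F\<close> takes its prescribed color with probability \<open>1 / k\<close>. The sum
  counts the colorings that agree with \<open>\<tau>\<close> on \<open>F\<close>.\<close>

lemma fraction_colorings_prescribed:
  assumes "F \<subseteq> complete_edges n" "\<tau> \<in> F \<rightarrow> {1..k}" "k \<ge> 1"
  shows "(\<Sum>X\<in>colorings n k. \<Prod>e\<in>F. if X e = \<tau> e then 1 else 0) / real (card (colorings n k))
    = (1 / real k) ^ card F"
proof -
  let ?C = "complete_edges n"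
  \<comment> \<open>Factors equal to 1 outside \<open>F\<close> extend the product to all edges of
    the complete graph.\<close>
  define f where "f = (\<lambda>e a. if e \<in> F then (if a = \<tau> e then 1 else 0) else (1::real))"
  have fin: "finite ?C" by (rule finite_complete_edges)
  have "(\<Sum>X\<in>colorings n k. \<Prod>e\<in>F. if X e = \<tau> e then 1 else (0::real))
      = (\<Sum>X\<in>colorings n k. \<Prod>e\<in>?C. f e (X e))"
  proof (rule sum.cong)
    fix X
    have "(\<Prod>e\<in>?C. f e (X e)) = (\<Prod>e\<in>F. f e (X e))"
      by (rule prod.mono_neutral_right[OF fin assms(1)]) (auto simp: f_def)
    then show "(\<Prod>e\<in>F. if X e = \<tau> e then 1 else (0::real)) = (\<Prod>e\<in>?C. f e (X e))"
      by (simp add: f_def)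
  qed simp
  \<comment> \<open>Independence in counting form: the sum over all colorings factorizes over the
    edges. A prescribed edge then contributes 1 and a free one \<open>k\<close>.\<close>
  also have "\<dots> = (\<Prod>e\<in>?C. \<Sum>a\<in>{1..k}. f e a)"
    unfolding colorings_def by (rule prod_sum_PiE[symmetric]) (auto intro: fin)
  also have "\<dots> = (\<Prod>e\<in>?C. if e \<in> F then 1 else real k)"
    using assms(2) by (intro prod.cong) (auto simp: f_def Pi_iff)
  also have "\<dots> = real k ^ card (?C - F)"
    using fin by (simp add: prod.If_cases Diff_eq)
  finally have *: "(\<Sum>X\<in>colorings n k. \<Prod>e\<in>F. if X e = \<tau> e then 1 else (0::real)) = real k ^ card (?C - F)" .
  have "card ?C = card (?C - F) + card F"
    using assms(1) fin by (metis card_Diff_subset card_mono finite_subset le_add_diff_inverse2)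
  moreover have "real (card (colorings n k)) = real k ^ card ?C"
    by (simp add: colorings_def card_funcsetE fin)
  ultimately show ?thesis
    using assms(3) * by (simp add: power_add power_divide)
qed

text \<open>Vertices in distinct blocks send the edges of \<open>H\<close> to distinct edges of the complete
  graph, so the factors of the product are independent under a uniformly random coloring.\<close>

lemma average_empirical_weight:
  fixes H :: "'v::linorder graph"
  assumes H: "finite_simple_graph H" and \<sigma>: "\<sigma> \<in> edges H \<rightarrow> {1..k}" and k: "k \<ge> 1"
    and inj: "inj_on (\<lambda>v. block n (x v)) (verts H)"
    and ran: "\<forall>v\<in>verts H. block n (x v) \<in> {1..n}"
  shows "(\<Sum>X\<in>colorings n k. \<Prod>e\<in>edges H. empirical_graphon n k X (\<sigma> e) (x (Min e)) (x (Max e)))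
      / real (card (colorings n k)) = (1 / real k) ^ card (edges H)"
proof -
  define b where "b = (\<lambda>v. block n (x v))"
  have injb: "inj_on b (verts H)" using inj by (simp add: b_def)
  have sub: "\<And>e. e \<in> edges H \<Longrightarrow> e \<subseteq> verts H \<and> card e = 2"
    using H by (auto simp: finite_simple_graph_def)
  have injE: "inj_on ((`) b) (edges H)"
    using injb sub by (intro inj_on_subset[OF inj_on_image_Pow[OF injb]]) auto
  \<comment> \<open>Each edge in the image comes from a unique edge of \<open>H\<close>, so
    \<open>\<sigma>\<close> can be transported to the complete graph.\<close>
  define \<tau> where "\<tau> = (\<lambda>f. \<sigma> (the_inv_into (edges H) ((`) b) f))"
  have \<tau>: "\<tau> (b ` e) = \<sigma> e" if "e \<in> edges H" for e
    unfolding \<tau>_def using the_inv_into_f_f[OF injE that] by simp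
  have weight: "empirical_graphon n k X (\<sigma> e) (x (Min e)) (x (Max e)) = (if X (b ` e) = \<tau> (b ` e) then 1 else 0)"
    if "e \<in> edges H" for X e
  proof -
    note e = finite_simple_graph_edgeE[OF H that]
    \<comment> \<open>The block indices are distinct and nonzero, so the default value
      \<open>1 / k\<close> does not occur and the weight is an indicator.\<close>
    have "b (Min e) \<noteq> b (Max e)" using inj_onD[OF injb] e by blast
    moreover have "b (Min e) \<noteq> 0" "b (Max e) \<noteq> 0" using ran e unfolding b_def by fastforce+
    moreover have "b ` e = {b (Min e), b (Max e)}" by (subst e(1)) simp
    ultimately show ?thesis
      unfolding \<tau>[OF that] by (simp add: empirical_graphon_def b_def)
  qed
  have "(\<Prod>e\<in>edges H. empirical_graphon n k X (\<sigma> e) (x (Min e)) (x (Max e)))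
      = (\<Prod>f\<in>(`) b ` edges H. if X f = \<tau> f then 1 else 0)" for X
    by (subst prod.reindex[OF injE]) (auto intro!: prod.cong weight)
  moreover have "(`) b ` edges H \<subseteq> complete_edges n"
  proof safe
    fix e assume e: "e \<in> edges H"
    have "card (b ` e) = 2" using sub[OF e] card_image[OF inj_on_subset[OF injb]] by auto
    moreover have "b ` e \<subseteq> {1..n}" using ran sub[OF e] by (auto simp: b_def subset_iff)
    ultimately show "b ` e \<in> complete_edges n" by (simp add: complete_edges_def)
  qed
  moreover have "\<tau> \<in> (`) b ` edges H \<rightarrow> {1..k}" using \<sigma> by (auto simp: \<tau> Pi_iff)
  ultimately show ?thesis
    using fraction_colorings_prescribed[of "(`) b ` edges H" n \<tau> k] k card_image[OF injE] by simp
qed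

text \<open>Averaging over colorings is done inside the integral. At almost every \<open>x\<close>
  the averaged integrand \<open>s n x\<close> is eventually equal to its limit, and it always lies
  between 0 and 1, so dominated convergence applies.\<close>

lemma average_hom_density_tendsto:
  fixes H :: "'v::linorder graph"
  assumes H: "finite_simple_graph H" and \<sigma>: "\<sigma> \<in> edges H \<rightarrow> {1..k}" and k: "k \<ge> 1"
  shows "(\<lambda>n. (\<Sum>X\<in>colorings n k. hom_density H \<sigma> (empirical_graphon n k X)) / real (card (colorings n k)))
    \<longlonglongrightarrow> (1 / real k) ^ card (edges H)"
proof -
  define M where "M = (\<Pi>\<^sub>M v\<in>verts H. unit_measure)"
  interpret M: prob_space M unfolding M_def by (rule prob_space_unit_cube)
  define p where "p = (\<lambda>n X x. \<Prod>e\<in>edges H. empirical_graphon n k X (\<sigma> e) (x (Min e)) (x (Max e)))"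
  define s where "s = (\<lambda>n x. (\<Sum>X\<in>colorings n k. p n X x) / real (card (colorings n k)))"
  have p_meas [measurable]: "p n X \<in> borel_measurable M" for n X
    unfolding p_def M_def using finite_simple_graph_edgeE[OF H]
    by (intro borel_measurable_prod empirical_graphon_measurable component_measurable_unit_cube) auto
  have p_bounds: "0 \<le> p n X x" "p n X x \<le> 1" if "x \<in> space M" "X \<in> colorings n k" for n X x
    using edge_weight_product_bounds[OF H \<sigma> empirical_graphon_mem_graphons[OF k]] that
    unfolding p_def M_def by auto
  have p_int: "integrable M (p n X)" if "X \<in> colorings n k" for n X
    by (rule M.integrable_const_bound[where B = 1]) (use p_bounds that in auto)
  have "(\<lambda>n. integral\<^sup>L M (s n)) \<longlonglongrightarrow> integral\<^sup>L M (\<lambda>_. (1 / real k) ^ card (edges H))"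
  proof (rule integral_dominated_convergence[where w = "\<lambda>_. 1"])
    show "AE x in M. (\<lambda>n. s n x) \<longlonglongrightarrow> (1 / real k) ^ card (edges H)"
    proof -
      have "AE x in M. inj_on x (verts H) \<and> (\<forall>v\<in>verts H. x v \<in> {0<..1})"
        unfolding M_def using H by (intro AE_unit_cube_distinct) (simp add: finite_simple_graph_def)
      then show ?thesis
      proof eventually_elim
        case (elim x)
        then have "\<forall>\<^sub>F n in sequentially. s n x = (1 / real k) ^ card (edges H)"
          using eventually_block_inj[of "verts H" x] H unfolding finite_simple_graph_def s_def p_def
          by (auto elim!: eventually_mono intro!: average_empirical_weight[OF H \<sigma> k])
        then show ?case by (rule tendsto_eventually)
      qed
    qed
    show "AE x in M. norm (s n x) \<le> 1" for n
    proof (rule AE_I2)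
      fix x assume x: "x \<in> space M"
      have "0 \<le> (\<Sum>X\<in>colorings n k. p n X x)" using p_bounds x by (intro sum_nonneg) auto
      moreover have "(\<Sum>X\<in>colorings n k. p n X x) \<le> real (card (colorings n k)) * 1"
        using p_bounds x by (intro sum_bounded_above) auto
      ultimately show "norm (s n x) \<le> 1" by (simp add: s_def divide_le_eq)
    qed
  qed (auto simp: s_def)
  moreover have "integral\<^sup>L M (s n)
      = (\<Sum>X\<in>colorings n k. hom_density H \<sigma> (empirical_graphon n k X)) / real (card (colorings n k))" for n
    unfolding s_def using p_int by (simp add: hom_density_def p_def M_def)
  ultimately show ?thesis by (simp add: M.prob_space)
qed

lemma average_rainbow_density_tendsto:
  fixes H :: "'v::linorder graph"
  assumes H: "finite_simple_graph H" "card (edges H) \<le> k" and k: "k \<ge> 1"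
  shows "(\<lambda>n. (\<Sum>X\<in>colorings n k. rainbow_density H k (empirical_graphon n k X)) / real (card (colorings n k)))
    \<longlonglongrightarrow> uniform_rainbow_value H k"
proof -
  have "(\<lambda>n. \<Sum>\<sigma> | \<sigma> \<in> edges H \<rightarrow>\<^sub>E {1..k} \<and> inj_on \<sigma> (edges H).
        (\<Sum>X\<in>colorings n k. hom_density H \<sigma> (empirical_graphon n k X)) / real (card (colorings n k)))
      \<longlonglongrightarrow> uniform_rainbow_value H k"
    unfolding sum_inj_colorings_const[OF H, symmetric]
    by (intro tendsto_sum average_hom_density_tendsto H k) (auto simp: PiE_def)
  then show ?thesis
    unfolding rainbow_density_def by (subst sum.swap) (simp add: sum_divide_distrib)
qed

text \<open>Jensen's inequality for \<open>exp\<close>, derived from its tangent line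
  \<open>1 + t \<le> exp t\<close> at the deviations from the mean.\<close>

lemma ln_sum_exp_ge:
  fixes f :: "'a \<Rightarrow> real"
  assumes "finite A" "A \<noteq> {}"
  shows "ln (real (card A)) + (\<Sum>x\<in>A. f x) / real (card A) \<le> ln (\<Sum>x\<in>A. exp (f x))"
proof -
  define m where "m = (\<Sum>x\<in>A. f x) / real (card A)"
  have card: "real (card A) > 0" using assms by (simp add: card_gt_0_iff)
  \<comment> \<open>The deviations from the mean \<open>m\<close> sum to zero.\<close>
  have "real (card A) = (\<Sum>x\<in>A. 1 + (f x - m))"
    using card by (simp add: sum.distrib sum_subtractf m_def)
  also have "\<dots> \<le> (\<Sum>x\<in>A. exp (f x - m))" by (intro sum_mono exp_ge_add_one_self)
  also have "\<dots> = (\<Sum>x\<in>A. exp (f x)) / exp m" by (simp add: exp_diff sum_divide_distrib)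
  finally have "real (card A) * exp m \<le> (\<Sum>x\<in>A. exp (f x))" by (simp add: field_simps)
  then have "ln (real (card A) * exp m) \<le> ln (\<Sum>x\<in>A. exp (f x))"
    using card by (intro ln_mono) auto
  then show ?thesis using card by (simp add: ln_mult m_def)
qed

section \<open>Entropy\<close>

text \<open>This is one term of the relative entropy with respect to the uniform distribution, plus
  the correction \<open>1 / k - \<mu>\<close>. The correction makes each term nonnegative by itself,
  and the corrections cancel when summed over the colors.\<close>

lemma entropy_term_ge:
  fixes \<mu> :: real
  assumes "k \<ge> 1" "0 \<le> \<mu>"
  shows "0 \<le> \<mu> * ln \<mu> + \<mu> * ln (real k) - \<mu> + 1 / real k"
    and "\<mu> * ln \<mu> + \<mu> * ln (real k) - \<mu> + 1 / real k = 0 \<Longrightarrow> \<mu> = 1 / real k"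
proof -
  \<comment> \<open>At \<open>\<mu> = 0\<close> the expression is \<open>1 / k\<close>. Elsewhere
    the strict tangent-line bound for \<open>ln\<close> at \<open>\<mu>\<close>, multiplied by
    \<open>\<mu>\<close>, gives the claim.\<close>
  have "0 < \<mu> * ln \<mu> + \<mu> * ln (real k) - \<mu> + 1 / real k" if "\<mu> \<noteq> 1 / real k"
  proof (cases "\<mu> = 0")
    case False
    then have "ln (1 / real k) - ln \<mu> < (1 / real k - \<mu>) / \<mu>"
      using assms that by (intro ln_diff_less) auto
    then have "\<mu> * (ln (1 / real k) - ln \<mu>) < 1 / real k - \<mu>"
      using assms False by (simp add: pos_less_divide_eq mult.commute)
    then show ?thesis using assms by (simp add: ln_div algebra_simps)
  qed (use assms in auto)
  moreover have "\<mu> * ln \<mu> + \<mu> * ln (real k) - \<mu> + 1 / real k = 0" if "\<mu> = 1 / real k"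
    using assms that by (simp add: ln_div)
  ultimately show "0 \<le> \<mu> * ln \<mu> + \<mu> * ln (real k) - \<mu> + 1 / real k"
    and "\<mu> * ln \<mu> + \<mu> * ln (real k) - \<mu> + 1 / real k = 0 \<Longrightarrow> \<mu> = 1 / real k"
    by fastforce+
qed

lemma graphon_entropy_uniform:
  assumes "k \<ge> 1"
  shows "graphon_entropy k (uniform_graphon k) = - ln (real k)"
proof -
  interpret prob_space "unit_measure \<Otimes>\<^sub>M unit_measure" by (rule prob_space_unit_square)
  show ?thesis
    using assms by (simp add: graphon_entropy_def uniform_graphon_def case_prod_unfold prob_space ln_div)
qed

text \<open>The entropy plus \<open>ln k\<close> is the integral of the nonnegative function
  \<open>g\<close>, the sum of the terms above. If the integral vanishes, then \<open>g\<close> and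
  hence every term is zero almost everywhere, which forces each weight to be
  \<open>1 / k\<close>.\<close>

lemma graphon_entropy_ge:
  assumes k: "k \<ge> 1" and W: "W \<in> graphons k"
  shows "- ln (real k) \<le> graphon_entropy k W"
    and "graphon_entropy k W = - ln (real k) \<Longrightarrow> graphon_eq k W (uniform_graphon k)"
proof -
  define M where "M = unit_measure \<Otimes>\<^sub>M unit_measure"
  interpret M: prob_space M unfolding M_def by (rule prob_space_unit_square)
  define w where "w = (\<lambda>a (z::real \<times> real). W a (fst z) (snd z))"
  have w_meas [measurable]: "w a \<in> borel_measurable M" if "a \<in> {1..k}" for a
    using W that by (simp add: graphons_def w_def M_def case_prod_unfold)
  have w_bounds: "0 \<le> w a z" "w a z \<le> 1" if "a \<in> {1..k}" "z \<in> space M" for a z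
    using graphons_bounds[OF W that(1)] that(2) by (auto simp: w_def M_def space_pair_measure)
  have w_sum: "(\<Sum>a\<in>{1..k}. w a z) = 1" if "z \<in> space M" for z
    using W that by (auto simp: graphons_def prob_simplex_def w_def M_def space_pair_measure)
  define h where "h = (\<lambda>a z. w a z * ln (w a z) + w a z * ln (real k) - w a z + 1 / real k)"
  have w_int: "integrable M (w a)" if "a \<in> {1..k}" for a
    by (rule M.integrable_const_bound[where B = 1]) (use w_bounds that in auto)
  have wln_int: "integrable M (\<lambda>z. w a z * ln (w a z))" if a: "a \<in> {1..k}" for a
  proof (rule M.integrable_const_bound[where B = 1])
    show "AE z in M. norm (w a z * ln (w a z)) \<le> 1"
    proof (rule AE_I2)
      fix z assume z: "z \<in> space M"
      note b = w_bounds[OF a z]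
      have "w a z * ln (w a z) \<le> 0" using b by (cases "w a z = 0") (auto intro: mult_nonneg_nonpos)
      \<comment> \<open>The case \<open>k = 1\<close> of the termwise bound shows that
        \<open>w ln w\<close> is at least \<open>w - 1\<close>, hence at least
        \<open>-1\<close>.\<close>
      moreover have "0 \<le> w a z * ln (w a z) - w a z + 1"
        using entropy_term_ge(1)[of 1 "w a z"] b by simp
      ultimately show "norm (w a z * ln (w a z)) \<le> 1" using b by simp
    qed
  qed (use a in measurable)
  have h_int: "integrable M (h a)" if "a \<in> {1..k}" for a
    unfolding h_def using w_int[OF that] wln_int[OF that] by simp
  have h_nonneg: "0 \<le> h a z" if "a \<in> {1..k}" "z \<in> space M" for a z
    unfolding h_def using entropy_term_ge(1)[OF k w_bounds(1)[OF that]] .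
  define g where "g = (\<lambda>z. \<Sum>a\<in>{1..k}. h a z)"
  have g_int: "integrable M g" unfolding g_def by (intro Bochner_Integration.integrable_sum h_int)
  have g_nonneg: "0 \<le> g z" if "z \<in> space M" for z
    unfolding g_def using h_nonneg that by (intro sum_nonneg) auto
  have entropy_eq: "graphon_entropy k W = (\<integral>z. (\<Sum>a\<in>{1..k}. w a z * ln (w a z)) \<partial>M)"
    using Bochner_Integration.integral_sum[of "{1..k}" M "\<lambda>a z. w a z * ln (w a z)", OF wln_int]
    by (simp add: graphon_entropy_def w_def M_def case_prod_unfold)
  have entropy_int: "integrable M (\<lambda>z. \<Sum>a\<in>{1..k}. w a z * ln (w a z))"
    by (intro Bochner_Integration.integrable_sum wln_int)
  have "integral\<^sup>L M g = (\<integral>z. (\<Sum>a\<in>{1..k}. w a z * ln (w a z)) + ln (real k) \<partial>M)"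
  proof (rule Bochner_Integration.integral_cong)
    fix z assume z: "z \<in> space M"
    \<comment> \<open>The final 1 is \<open>k\<close> copies of \<open>1 / k\<close>; it cancels
      against the total weight, which is 1.\<close>
    have "g z = (\<Sum>a\<in>{1..k}. w a z * ln (w a z)) + (\<Sum>a\<in>{1..k}. w a z) * ln (real k)
        - (\<Sum>a\<in>{1..k}. w a z) + 1"
      using k by (simp add: g_def h_def sum.distrib sum_subtractf sum_distrib_right)
    then show "g z = (\<Sum>a\<in>{1..k}. w a z * ln (w a z)) + ln (real k)" unfolding w_sum[OF z] by simp
  qed simp
  also have "\<dots> = graphon_entropy k W + ln (real k)"
    unfolding entropy_eq
    by (subst Bochner_Integration.integral_add[OF entropy_int]) (simp_all add: M.prob_space)
  finally have g_eq: "integral\<^sup>L M g = graphon_entropy k W + ln (real k)" .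
  have "0 \<le> integral\<^sup>L M g" using g_nonneg by (rule Bochner_Integration.integral_nonneg)
  then show "- ln (real k) \<le> graphon_entropy k W" by (simp add: g_eq)
  assume "graphon_entropy k W = - ln (real k)"
  then have "AE z in M. g z = 0"
    using integral_nonneg_eq_0_iff_AE[OF g_int] g_nonneg g_eq by auto
  then have "AE z in M. \<forall>a\<in>{1..k}. w a z = 1 / real k"
    using AE_space
  proof eventually_elim
    case (elim z)
    then have "\<forall>a\<in>{1..k}. h a z = 0"
      unfolding g_def using h_nonneg by (subst (asm) sum_nonneg_eq_0_iff) auto
    then show ?case
      using entropy_term_ge(2)[OF k] w_bounds(1) elim(2) unfolding h_def by blast
  qed
  then show "graphon_eq k W (uniform_graphon k)"
    unfolding graphon_eq_def uniform_graphon_def w_def M_def case_prod_unfold .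
qed

section \<open>The free energy\<close>

lemma rainbow_hamiltonian_le:
  assumes "\<forall>s\<in>{1..r}. rainbow_common k (H s)" "\<forall>s\<in>{1..r}. \<beta> s \<ge> 0" "W \<in> graphons k"
  shows "rainbow_hamiltonian k r \<beta> H W \<le> (\<Sum>s\<in>{1..r}. \<beta> s * uniform_rainbow_value (H s) k)"
  unfolding rainbow_hamiltonian_def using assms
  by (intro sum_mono mult_left_mono rainbow_density_le) auto

text \<open>There are \<open>n (n - 1) / 2\<close> edges with \<open>k\<close> choices each.
  Dividing by the square of \<open>n\<close> leaves one half of \<open>ln k\<close> up to a
  vanishing correction.\<close>

lemma ln_card_colorings:
  assumes "k \<ge> 1" "n \<ge> 1"
  shows "1 / real n ^ 2 * ln (real (card (colorings n k))) = (1 / 2 - 1 / (2 * real n)) * ln (real k)"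
proof -
  have choose: "real (n choose 2) = real n * (real n - 1) / 2"
    using assms by (simp add: choose_two real_of_nat_div of_nat_diff)
  have "ln (real (card (colorings n k))) = real (n choose 2) * ln (real k)"
    using assms by (simp add: card_colorings ln_realpow)
  then show ?thesis
    unfolding choose using assms by (simp add: power2_eq_square field_simps)
qed

text \<open>Both bounds contain the same counting term \<open>c n\<close>, so they differ only by
  \<open>C - A n\<close>, which tends to zero.\<close>

lemma free_energy_tendsto:
  fixes H :: "nat \<Rightarrow> 'v::linorder graph"
  assumes k: "k \<ge> 1"
    and H: "\<forall>s\<in>{1..r}. rainbow_common k (H s)"
    and \<beta>: "\<forall>s\<in>{1..r}. \<beta> s \<ge> 0"
  shows "free_energy k r \<beta> H
    \<longlonglongrightarrow> (\<Sum>s\<in>{1..r}. \<beta> s * uniform_rainbow_value (H s) k) + 1 / 2 * ln (real k)"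
proof -
  define C where "C = (\<Sum>s\<in>{1..r}. \<beta> s * uniform_rainbow_value (H s) k)"
  define T where "T = (\<lambda>n X. rainbow_hamiltonian k r \<beta> H (empirical_graphon n k X))"
  define A where "A = (\<lambda>n. (\<Sum>X\<in>colorings n k. T n X) / real (card (colorings n k)))"
  define c where "c = (\<lambda>n::nat. (1 / 2 - 1 / (2 * real n)) * ln (real k))"
  have nonempty: "colorings n k \<noteq> {}" for n
    using k unfolding colorings_def by (simp add: PiE_eq_empty_iff)
  have pos: "0 < real (card (colorings n k))" for n
    using nonempty finite_colorings by (simp add: card_gt_0_iff)
  have upper: "free_energy k r \<beta> H n \<le> C + c n" if n: "n \<ge> 1" for n
  proof -
    have "(\<Sum>X\<in>colorings n k. exp (real n ^ 2 * T n X)) \<le> real (card (colorings n k)) * exp (real n ^ 2 * C)"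
      using rainbow_hamiltonian_le[OF H \<beta> empirical_graphon_mem_graphons[OF k]]
      by (intro sum_bounded_above) (auto simp: T_def C_def intro!: mult_left_mono)
    moreover have "0 < (\<Sum>X\<in>colorings n k. exp (real n ^ 2 * T n X))"
      using nonempty finite_colorings by (intro sum_pos) auto
    ultimately have "ln (\<Sum>X\<in>colorings n k. exp (real n ^ 2 * T n X))
        \<le> ln (real (card (colorings n k)) * exp (real n ^ 2 * C))" by (intro ln_mono)
    also have "\<dots> = ln (real (card (colorings n k))) + real n ^ 2 * C"
      using pos by (simp add: ln_mult)
    finally have "free_energy k r \<beta> H n \<le> 1 / real n ^ 2 * (ln (real (card (colorings n k))) + real n ^ 2 * C)"
      unfolding free_energy_def T_def by (intro mult_left_mono) auto
    also have "\<dots> = c n + C"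
      using ln_card_colorings[OF k n] n by (simp add: c_def distrib_left)
    finally show ?thesis by simp
  qed
  have lower: "A n + c n \<le> free_energy k r \<beta> H n" if n: "n \<ge> 1" for n
  proof -
    have "c n + A n = 1 / real n ^ 2 * (ln (real (card (colorings n k)))
        + (\<Sum>X\<in>colorings n k. real n ^ 2 * T n X) / real (card (colorings n k)))"
      using ln_card_colorings[OF k n] n
      by (simp add: c_def A_def distrib_left flip: sum_distrib_left)
    also have "\<dots> \<le> free_energy k r \<beta> H n"
      unfolding free_energy_def T_def
      by (intro mult_left_mono ln_sum_exp_ge finite_colorings nonempty) auto
    finally show ?thesis by simp
  qed
  have "(\<lambda>n. \<Sum>s\<in>{1..r}. \<beta> s * ((\<Sum>X\<in>colorings n k. rainbow_density (H s) k (empirical_graphon n k X))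
      / real (card (colorings n k)))) \<longlonglongrightarrow> C"
    unfolding C_def using H k
    by (intro tendsto_sum tendsto_mult_left average_rainbow_density_tendsto) (auto simp: rainbow_common_def)
  \<comment> \<open>Exchanging the sums over graphs and over colorings identifies the combination of
    averaged densities with the average Hamiltonian.\<close>
  also have "(\<lambda>n. \<Sum>s\<in>{1..r}. \<beta> s * ((\<Sum>X\<in>colorings n k. rainbow_density (H s) k (empirical_graphon n k X))
      / real (card (colorings n k)))) = A"
    unfolding A_def T_def rainbow_hamiltonian_def
    by (subst sum.swap) (simp add: sum_divide_distrib sum_distrib_left)
  finally have A: "A \<longlonglongrightarrow> C" .
  have c: "c \<longlonglongrightarrow> 1 / 2 * ln (real k)"
  proof -
    have "(\<lambda>n. (1 / 2 - 1 / 2 * (1 / real n)) * ln (real k)) \<longlonglongrightarrow> (1 / 2 - 1 / 2 * 0) * ln (real k)"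
      by (intro tendsto_intros lim_1_over_n)
    then show ?thesis by (simp add: c_def)
  qed
  have "free_energy k r \<beta> H \<longlonglongrightarrow> C + 1 / 2 * ln (real k)"
  proof (rule tendsto_sandwich)
    show "\<forall>\<^sub>F n in sequentially. A n + c n \<le> free_energy k r \<beta> H n"
      using lower by (auto simp: eventually_sequentially)
    show "\<forall>\<^sub>F n in sequentially. free_energy k r \<beta> H n \<le> C + c n"
      using upper by (auto simp: eventually_sequentially)
  qed (intro tendsto_intros A c)+
  then show ?thesis by (simp add: C_def)
qed

theorem proposition3p17:
  fixes k r :: nat
    and H :: "nat \<Rightarrow> 'v::linorder graph"
    and \<beta> :: "nat \<Rightarrow> real"
  assumes "k \<ge> 2"
    and "\<forall>s\<in>{1..r}. rainbow_common k (H s)"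
    and "\<forall>s\<in>{1..r}. \<beta> s \<ge> 0"
  shows "(free_energy k r \<beta> H \<longlonglongrightarrow>
            (\<Sum>s\<in>{1..r}. \<beta> s * (fact k / (fact (k - card (edges (H s))) * real k ^ card (edges (H s)))))
              + 1 / 2 * ln (real k)) \<and>
    is_arg_max (\<lambda>W. rainbow_hamiltonian k r \<beta> H W - 1 / 2 * graphon_entropy k W)
         (\<lambda>W. W \<in> graphons k) (uniform_graphon k) \<and>
    (\<forall>W. is_arg_max (\<lambda>W. rainbow_hamiltonian k r \<beta> H W - 1 / 2 * graphon_entropy k W)
            (\<lambda>W. W \<in> graphons k) W \<longrightarrow> graphon_eq k W (uniform_graphon k))"
proof -
  have k: "k \<ge> 1" using assms(1) by simp
  define C where "C = (\<Sum>s\<in>{1..r}. \<beta> s * uniform_rainbow_value (H s) k)"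
  let ?F = "\<lambda>W. rainbow_hamiltonian k r \<beta> H W - 1 / 2 * graphon_entropy k W"
  have "rainbow_hamiltonian k r \<beta> H (uniform_graphon k) = C"
    unfolding rainbow_hamiltonian_def C_def using assms(2)
    by (intro sum.cong refl) (simp add: rainbow_density_uniform rainbow_common_def)
  then have uniform: "?F (uniform_graphon k) = C + 1 / 2 * ln (real k)"
    by (simp add: graphon_entropy_uniform[OF k])
  have le: "?F W \<le> C + 1 / 2 * ln (real k)" if "W \<in> graphons k" for W
    using rainbow_hamiltonian_le[OF assms(2,3) that] graphon_entropy_ge(1)[OF k that]
    by (simp add: C_def)
  have "free_energy k r \<beta> H \<longlonglongrightarrow> C + 1 / 2 * ln (real k)"
    unfolding C_def by (rule free_energy_tendsto[OF k assms(2,3)])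
  moreover have "is_arg_max ?F (\<lambda>W. W \<in> graphons k) (uniform_graphon k)"
    unfolding is_arg_max_linorder uniform using le uniform_graphon_mem_graphons[OF k] by auto
  moreover have "graphon_eq k W (uniform_graphon k)"
    if "is_arg_max ?F (\<lambda>W. W \<in> graphons k) W" for W
  proof -
    \<comment> \<open>A maximizer reaches the value at the uniform graphon, while its Hamiltonian is
      at most \<open>C\<close> and its entropy at least \<open>- ln k\<close>. So both bounds are
      attained, and the equality case for the entropy identifies \<open>W\<close>.\<close>
    from that have W: "W \<in> graphons k" and "?F (uniform_graphon k) \<le> ?F W"
      using uniform_graphon_mem_graphons[OF k] by (auto simp: is_arg_max_linorder)
    then have "graphon_entropy k W = - ln (real k)"
      using rainbow_hamiltonian_le[OF assms(2,3) W] graphon_entropy_ge(1)[OF k W] uniform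
      by (simp add: C_def)
    then show ?thesis by (rule graphon_entropy_ge(2)[OF k W])
  qed
  ultimately show ?thesis unfolding C_def uniform_rainbow_value_def by blast
qed

end
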